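(* Let $\langle\mathfrak V,\mathfrak W;X,Y\rangle$ be a $(\Theta,\mathcal E)$-structure, $\mathfrak V=\langle\langle\mathfrak E,\tau\rangle,\pi,X,\{\nu_j:j\in J\}\rangle$, $\mathfrak W=\langle\langle\mathfrak M,\gamma\rangle,\rho,X,\mathfrak R\rangle$. Let $x_\infty\in W\subseteq X$ and $\mathcal U\in\prod^b_{x\in W}\mathfrak M_x$. For an open set $U\ni x_\infty$ and $F\in\Gamma_U(\rho)$, let $(\ast)_{U,F,j,K,B}$ denote the condition $$\lim_{z\to x_\infty,\ z\in W\cap U}\ \sup_{t\in K}\ \sup_{v\in\mathsf D(B,\mathcal E)}\nu_j\bigl(\mathcal U(z)(t)v(z)-F(z)(t)v(z)\bigr)=0 .$$ Consider: (1) $\mathcal U\in\Gamma_W^{x_\infty}(\rho)$; (2) there exist an open $U\subseteq X$ with $x_\infty\in U$ and $F\in\Gamma_U(\rho)$ with $F(x_\infty)=\mathcal U(x_\infty)$ such that $(\ast)_{U,F,j,K,B}$ holds for all $j\in J$, all compact $K\subseteq Y$ and all $B\in\Theta$; (3) there exist an open $U'\subseteq X$ with $x_\infty\in U'$ and $F'\in\Gamma_{U'}(\rho)$ with $F'(x_\infty)=\mathcal U(x_\infty)$; and for every open $U\ni x_\infty$ and every $F\in\Gamma_U(\rho)$ with $F(x_\infty)=\mathcal U(x_\infty)$, $(\ast)_{U,F,j,K,B}$ holds for all $j\in J$, all compact $K\subseteq Y$ and all $B\in\Theta$; (4) there exist an open $U'\subseteq X$ with $x_\infty\in U'$ and $F'\in\Gamma_{U'}(\rho)$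 with $F'(x_\infty)=\mathcal U(x_\infty)$; and $\mathcal U\in\Gamma_W^{x_\infty}(\rho)$. Then $(3)\Leftrightarrow(4)$, $(3)\Rightarrow(2)$ and $(2)\Rightarrow(1)$. If $\mathfrak W$ is locally full, then (1), (2), (3), (4) are equivalent. If $\mathfrak W$ is full, one can choose $U=X$ in (2) and $U'=X$ in (3) and (4).
   Context: Vector spaces are over $\mathbb K\in\{\mathbb R,\mathbb C\}$. Bundles. A bundle of $\Omega$-spaces $\langle\langle\mathfrak E,\tau\rangle,\pi,X,\mathfrak N\rangle$ (Gierz) consists of topological spaces $\langle\mathfrak E,\tau\rangle$ and $X$, a continuous open surjection $\pi:\mathfrak E\to X$, a vector space structure on each stalk $\mathfrak E_x=\pi^{-1}(x)$ such that addition $\{(a,b):\pi(a)=\pi(b)\}\to\mathfrak E$ and scalar multiplication are continuous, and a set $\mathfrak N=\{\nu_j:j\in J\}$ of functions $\mathfrak E\to[0,\infty[$ whose restrictions to each $\mathfrak E_x$ form a directed family of seminorms generating the (Hausdorff) topology induced by $\tau$ on $\mathfrak E_x$. For $U\subseteq X$, $\prod^b_{x\in U}\mathfrak E_x$ is the set of $\sigma\in\prod_{x\in U}\mathfrak E_x$ with $\sup_{x\in U}\nu_j(\sigma(x))<\infty$ for all $j$; $\Gamma_U(\pi)$ (resp. $\Gamma_U^x(\pi)$) is the set of those continuous (resp. continuous at $x\in U$) as maps $U\to\mathfrak E$; $\Gamma(\pi)=\Gamma_X(\pi)$. The tubes $\{\beta:\pi(\beta)\in U,\nu_j(\beta-\sigma(\pi(\beta)))<\varepsilon\}$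 ($U$ open, $\sigma\in\Gamma_U(\pi)$, $\varepsilon>0$, $j\in J$) form a base of $\tau$. The bundle is locally full (resp. full) if each $\alpha\in\mathfrak E$ equals $\sigma(\pi(\alpha))$ for some $\sigma\in\Gamma_U(\pi)$ with $U\ni\pi(\alpha)$ open (resp. for some $\sigma\in\Gamma(\pi)$). $(\Theta,\mathcal E)$-structure. Let $\mathcal E\subseteq\Gamma(\pi)$, $\Theta\subseteq\prod_xBounded(\mathfrak E_x)$, $\mathsf D(B,\mathcal E)=\mathcal E\cap\prod_xB(x)$, $\mathcal B_B^x=\{v(x):v\in\mathsf D(B,\mathcal E)\}$, $S_x=\{\mathcal B_B^x:B\in\Theta\}$; $\mathcal L_{S_x}(\mathfrak E_x)$ is the space of continuous linear endomorphisms of $\mathfrak E_x$ with the topology of uniform convergence on members of $S_x$. Let $Y$ be a Hausdorff space. $\langle\mathfrak V,\mathfrak W;X,Y\rangle$ is a $(\Theta,\mathcal E)$-structure if $\mathsf D(B,\mathcal E)\ne\emptyset$ for all $B\in\Theta$, $\bigcup_{B}\mathcal B_B^x$ is total in $\mathfrak E_x$ for all $x$, and $\mathfrak W$ is a bundle of $\Omega$-spaces whose stalk $\mathfrak M_x$ is a linear subspace of $\mathcal C(Y,\mathcal L_{S_x}(\mathfrak E_x))$ with directed family of seminorms $\sup_{(K,j,B)\in O}q^x_{(K,j,B)}$, $O$ ranging over finite subsets of $Comp(Y)\times J\times\Theta$ ($Comp(Y)$ = compact subsets of $Y$), where $q^x_{(K,j,B)}(f)=\sup_{t\in K}\sup_{v\in\mathsf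 D(B,\mathcal E)}\nu_j(f(t)v(x))$. *)

theory Defs
  imports "HOL-Analysis.Analysis" "HOL-Algebra.Module"
begin

(* The scalar field is passed as a set K of complex numbers, K = Reals or K = UNIV. *)
definition scalars :: "complex set \<Rightarrow> complex ring" where
  "scalars K = \<lparr>carrier = K, mult = (*), one = 1, zero = 0, add = (+)\<rparr>"

(* Supremum in [0,\<infinity>) of a family of nonnegative reals; the empty supremum is 0. *)
definition sup0 :: "'a set \<Rightarrow> ('a \<Rightarrow> real) \<Rightarrow> real" where
  "sup0 A f = Sup (insert 0 (f ` A))"

definition seminorm_on :: "complex set \<Rightarrow> (complex, 'e) module \<Rightarrow> ('e \<Rightarrow> real) \<Rightarrow> bool" where
  "seminorm_on K M p \<longleftrightarrow>
     (\<forall>a\<in>carrier M. 0 \<le> p a) \<and>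
     (\<forall>a\<in>carrier M. \<forall>b\<in>carrier M. p (a \<oplus>\<^bsub>M\<^esub> b) \<le> p a + p b) \<and>
     (\<forall>k\<in>K. \<forall>a\<in>carrier M. p (k \<odot>\<^bsub>M\<^esub> a) = cmod k * p a)"

definition directed_seminorms :: "(complex, 'e) module \<Rightarrow> 'j set \<Rightarrow> ('j \<Rightarrow> 'e \<Rightarrow> real) \<Rightarrow> bool" where
  "directed_seminorms M J p \<longleftrightarrow>
     J \<noteq> {} \<and>
     (\<forall>i\<in>J. \<forall>j\<in>J. \<exists>k\<in>J. \<forall>a\<in>carrier M. p i a \<le> p k a \<and> p j a \<le> p k a)"

(* The carrier is added to the balls so that an empty family gives the indiscrete topology. *)
definition seminorm_topology :: "(complex, 'e) module \<Rightarrow> 'j set \<Rightarrow> ('j \<Rightarrow> 'e \<Rightarrow> real) \<Rightarrow> 'e topology" where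
  "seminorm_topology M J p =
     topology_generated_by
       (insert (carrier M)
         {{b \<in> carrier M. p j (b \<ominus>\<^bsub>M\<^esub> a) < r} | j a r. j \<in> J \<and> a \<in> carrier M \<and> 0 < r})"

definition linear_span :: "complex set \<Rightarrow> (complex, 'e) module \<Rightarrow> 'e set \<Rightarrow> 'e set" where
  "linear_span K M A = \<Inter>{H. submodule H (scalars K) M \<and> A \<subseteq> H}"

definition pointwise_module ::
  "'a set \<Rightarrow> (complex, 'e) module \<Rightarrow> ('a \<Rightarrow> 'e) set \<Rightarrow> (complex, 'a \<Rightarrow> 'e) module" where
  "pointwise_module A M C =
     \<lparr>carrier = C, mult = undefined, one = undefined,
      zero = (\<lambda>a\<in>A. \<zero>\<^bsub>M\<^esub>),
      add = (\<lambda>f g. \<lambda>a\<in>A. f a \<oplus>\<^bsub>M\<^esub> g a),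
      smult = (\<lambda>k f. \<lambda>a\<in>A. k \<odot>\<^bsub>M\<^esub> f a)\<rparr>"


record ('e, 'x, 'j) bundle_data =
  total :: "'e topology"
  base :: "'x topology"
  proj :: "'e \<Rightarrow> 'x"
  stalk :: "'x \<Rightarrow> (complex, 'e) module"
  index :: "'j set"
  nu :: "'j \<Rightarrow> 'e \<Rightarrow> real"

definition stalk_topology :: "('e, 'x, 'j) bundle_data \<Rightarrow> 'x \<Rightarrow> 'e topology" where
  "stalk_topology V x = subtopology (total V) (carrier (stalk V x))"

definition bounded_sections :: "('e, 'x, 'j) bundle_data \<Rightarrow> 'x set \<Rightarrow> ('x \<Rightarrow> 'e) set" where
  "bounded_sections V U =
     {\<sigma> \<in> (\<Pi>\<^sub>E x\<in>U. carrier (stalk V x)). \<forall>j\<in>index V. bdd_above ((\<lambda>x. nu V j (\<sigma> x)) ` U)}"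

definition cont_sections :: "('e, 'x, 'j) bundle_data \<Rightarrow> 'x set \<Rightarrow> ('x \<Rightarrow> 'e) set" where
  "cont_sections V U =
     {\<sigma> \<in> bounded_sections V U. continuous_map (subtopology (base V) U) (total V) \<sigma>}"

definition cont_sections_at :: "('e, 'x, 'j) bundle_data \<Rightarrow> 'x set \<Rightarrow> 'x \<Rightarrow> ('x \<Rightarrow> 'e) set" where
  "cont_sections_at V U x =
     {\<sigma> \<in> bounded_sections V U. topcontinuous_at (subtopology (base V) U) (total V) \<sigma> x}"

definition tube :: "('e, 'x, 'j) bundle_data \<Rightarrow> 'x set \<Rightarrow> ('x \<Rightarrow> 'e) \<Rightarrow> real \<Rightarrow> 'j \<Rightarrow> 'e set" where
  "tube V U \<sigma> \<epsilon> j =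
     {\<beta> \<in> topspace (total V).
        proj V \<beta> \<in> U \<and> nu V j (\<beta> \<ominus>\<^bsub>stalk V (proj V \<beta>)\<^esub> \<sigma> (proj V \<beta>)) < \<epsilon>}"

definition tubes :: "('e, 'x, 'j) bundle_data \<Rightarrow> 'e set set" where
  "tubes V =
     {tube V U \<sigma> \<epsilon> j | U \<sigma> \<epsilon> j.
        openin (base V) U \<and> \<sigma> \<in> cont_sections V U \<and> 0 < \<epsilon> \<and> j \<in> index V}"

definition omega_bundle :: "complex set \<Rightarrow> ('e, 'x, 'j) bundle_data \<Rightarrow> bool" where
  "omega_bundle K V \<longleftrightarrow>
     continuous_map (total V) (base V) (proj V) \<and>
     open_map (total V) (base V) (proj V) \<and>
     proj V ` topspace (total V) = topspace (base V) \<and>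
     (\<forall>x\<in>topspace (base V).
        carrier (stalk V x) = {\<alpha> \<in> topspace (total V). proj V \<alpha> = x} \<and>
        Module.module (scalars K) (stalk V x)) \<and>
     continuous_map
       (subtopology (prod_topology (total V) (total V)) {(a, b). proj V a = proj V b})
       (total V) (\<lambda>(a, b). a \<oplus>\<^bsub>stalk V (proj V a)\<^esub> b) \<and>
     continuous_map
       (prod_topology (subtopology euclidean K) (total V))
       (total V) (\<lambda>(k, a). k \<odot>\<^bsub>stalk V (proj V a)\<^esub> a) \<and>
     (\<forall>x\<in>topspace (base V).
        (\<forall>j\<in>index V. seminorm_on K (stalk V x) (nu V j)) \<and>
        directed_seminorms (stalk V x) (index V) (nu V) \<and>
        stalk_topology V x = seminorm_topology (stalk V x) (index V) (nu V) \<and>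
        Hausdorff_space (stalk_topology V x)) \<and>
     openin (total V) = arbitrary union_of (\<lambda>T. T \<in> tubes V)"

definition locally_full :: "('e, 'x, 'j) bundle_data \<Rightarrow> bool" where
  "locally_full V \<longleftrightarrow>
     (\<forall>\<alpha>\<in>topspace (total V). \<exists>U. openin (base V) U \<and> proj V \<alpha> \<in> U \<and>
        (\<exists>\<sigma>\<in>cont_sections V U. \<sigma> (proj V \<alpha>) = \<alpha>))"

definition full :: "('e, 'x, 'j) bundle_data \<Rightarrow> bool" where
  "full V \<longleftrightarrow>
     (\<forall>\<alpha>\<in>topspace (total V). \<exists>\<sigma>\<in>cont_sections V (topspace (base V)). \<sigma> (proj V \<alpha>) = \<alpha>)"


definition bounded_subsets :: "('e, 'x, 'j) bundle_data \<Rightarrow> 'x \<Rightarrow> 'e set set" where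
  "bounded_subsets V x = {A. A \<subseteq> carrier (stalk V x) \<and> (\<forall>j\<in>index V. bdd_above (nu V j ` A))}"

definition D_sections ::
  "('e, 'x, 'j) bundle_data \<Rightarrow> ('x \<Rightarrow> 'e) set \<Rightarrow> ('x \<Rightarrow> 'e set) \<Rightarrow> ('x \<Rightarrow> 'e) set" where
  "D_sections V \<E> B = \<E> \<inter> (\<Pi>\<^sub>E x\<in>topspace (base V). B x)"

definition B_values ::
  "('e, 'x, 'j) bundle_data \<Rightarrow> ('x \<Rightarrow> 'e) set \<Rightarrow> 'x \<Rightarrow> ('x \<Rightarrow> 'e set) \<Rightarrow> 'e set" where
  "B_values V \<E> x B = (\<lambda>v. v x) ` D_sections V \<E> B"

definition stalk_endomorphisms ::
  "complex set \<Rightarrow> ('e, 'x, 'j) bundle_data \<Rightarrow> 'x \<Rightarrow> (complex, 'e \<Rightarrow> 'e) module" where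
  "stalk_endomorphisms K V x =
     (let E = stalk V x in
      pointwise_module (carrier E) E
        {f \<in> carrier E \<rightarrow>\<^sub>E carrier E.
           (\<forall>a\<in>carrier E. \<forall>b\<in>carrier E. f (a \<oplus>\<^bsub>E\<^esub> b) = f a \<oplus>\<^bsub>E\<^esub> f b) \<and>
           (\<forall>k\<in>K. \<forall>a\<in>carrier E. f (k \<odot>\<^bsub>E\<^esub> a) = k \<odot>\<^bsub>E\<^esub> f a) \<and>
           continuous_map (stalk_topology V x) (stalk_topology V x) f})"

(* Uniform convergence on the members of a family S of bounded subsets of the stalk. *)
definition endomorphism_topology ::
  "complex set \<Rightarrow> ('e, 'x, 'j) bundle_data \<Rightarrow> 'x \<Rightarrow> 'e set set \<Rightarrow> ('e \<Rightarrow> 'e) topology" where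
  "endomorphism_topology K V x S =
     seminorm_topology (stalk_endomorphisms K V x) (index V \<times> S)
       (\<lambda>(j, A) f. sup0 A (\<lambda>a. nu V j (f a)))"

definition cont_endomorphism_maps ::
  "complex set \<Rightarrow> ('e, 'x, 'j) bundle_data \<Rightarrow> 'y topology \<Rightarrow> 'x \<Rightarrow> 'e set set
     \<Rightarrow> (complex, 'y \<Rightarrow> 'e \<Rightarrow> 'e) module" where
  "cont_endomorphism_maps K V Y x S =
     pointwise_module (topspace Y) (stalk_endomorphisms K V x)
       {f \<in> extensional (topspace Y). continuous_map Y (endomorphism_topology K V x S) f}"

definition q_seminorm ::
  "('e, 'x, 'j) bundle_data \<Rightarrow> ('x \<Rightarrow> 'e) set \<Rightarrow> 'y set \<times> 'j \<times> ('x \<Rightarrow> 'e set)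
     \<Rightarrow> 'x \<Rightarrow> ('y \<Rightarrow> 'e \<Rightarrow> 'e) \<Rightarrow> real" where
  "q_seminorm V \<E> = (\<lambda>(C, j, B) x f.
     sup0 C (\<lambda>t. sup0 (D_sections V \<E> B) (\<lambda>v. nu V j (f t (v x)))))"

(* The total space of W consists of pairs (x, f) with f in the function space over x; the tag x
   keeps the stalks disjoint (also when Y is empty) and does not affect the linear structure. *)
definition Theta_E_structure ::
  "complex set \<Rightarrow> ('e, 'x, 'j) bundle_data
     \<Rightarrow> ('x \<times> ('y \<Rightarrow> 'e \<Rightarrow> 'e), 'x, ('y set \<times> 'j \<times> ('x \<Rightarrow> 'e set)) set) bundle_data
     \<Rightarrow> 'y topology \<Rightarrow> ('x \<Rightarrow> 'e set) set \<Rightarrow> ('x \<Rightarrow> 'e) set \<Rightarrow> bool" where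
  "Theta_E_structure K V W Y \<Theta> \<E> \<longleftrightarrow>
     omega_bundle K V \<and>
     Hausdorff_space Y \<and>
     \<E> \<subseteq> cont_sections V (topspace (base V)) \<and>
     \<Theta> \<subseteq> (\<Pi>\<^sub>E x\<in>topspace (base V). bounded_subsets V x) \<and>
     (\<forall>B\<in>\<Theta>. D_sections V \<E> B \<noteq> {}) \<and>
     (\<forall>x\<in>topspace (base V).
        stalk_topology V x closure_of linear_span K (stalk V x) (\<Union>B\<in>\<Theta>. B_values V \<E> x B)
          = carrier (stalk V x)) \<and>
     omega_bundle K W \<and>
     base W = base V \<and>
     (\<forall>x\<in>topspace (base V).
        let F = cont_endomorphism_maps K V Y x (B_values V \<E> x ` \<Theta>) in
        \<exists>M. submodule M (scalars K) F \<and>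
            carrier (stalk W x) = Pair x ` M \<and>
            (\<forall>f\<in>M. \<forall>g\<in>M. (x, f) \<oplus>\<^bsub>stalk W x\<^esub> (x, g) = (x, f \<oplus>\<^bsub>F\<^esub> g)) \<and>
            (\<forall>k\<in>K. \<forall>f\<in>M. k \<odot>\<^bsub>stalk W x\<^esub> (x, f) = (x, k \<odot>\<^bsub>F\<^esub> f))) \<and>
     index W = {Q. finite Q \<and> Q \<subseteq> {C. compactin Y C} \<times> index V \<times> \<Theta>} \<and>
     (\<forall>Q\<in>index W. \<forall>(x, f)\<in>topspace (total W). nu W Q (x, f) = sup0 Q (\<lambda>i. q_seminorm V \<E> i x f))"

definition uniform_limit_condition ::
  "('e, 'x, 'j) bundle_data \<Rightarrow> ('x \<Rightarrow> 'e) set \<Rightarrow> 'x set \<Rightarrow> 'x \<Rightarrow> ('x \<Rightarrow> 'x \<times> ('y \<Rightarrow> 'e \<Rightarrow> 'e))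
     \<Rightarrow> 'x set \<Rightarrow> ('x \<Rightarrow> 'x \<times> ('y \<Rightarrow> 'e \<Rightarrow> 'e)) \<Rightarrow> 'j \<Rightarrow> 'y set \<Rightarrow> ('x \<Rightarrow> 'e set) \<Rightarrow> bool" where
  "uniform_limit_condition V \<E> S x0 \<U> U F j C B \<longleftrightarrow>
     ((\<lambda>z. sup0 C (\<lambda>t. sup0 (D_sections V \<E> B) (\<lambda>v.
         nu V j (snd (\<U> z) t (v z) \<ominus>\<^bsub>stalk V z\<^esub> snd (F z) t (v z)))))
       \<longlongrightarrow> 0) (atin_within (base V) x0 (S \<inter> U))"

end

theory Submission
  imports Defs
begin

text \<open>
  Let \<open>F\<close> be a continuous section through \<open>\<U> x0\<close> on an open set \<open>U\<close>. Since the tubes around \<open>F\<close> are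
  open neighbourhoods of \<open>\<U> x0\<close>, continuity of \<open>\<U>\<close> at \<open>x0\<close> makes every seminorm of \<open>\<U> z - F z\<close> tend
  to \<open>0\<close>. Conversely, if these seminorms tend to \<open>0\<close> and \<open>\<U> x0 = F x0\<close> lies in a tube around \<open>\<sigma>\<close> of
  radius \<open>\<epsilon>\<close>, then \<open>F\<close> stays in a slightly thinner tube near \<open>x0\<close>, and the triangle inequality keeps
  \<open>\<U>\<close> in the original one. As the seminorms of \<open>W\<close> are finite maxima of the \<open>q_seminorm\<close>s, this
  convergence is the uniform limit condition for all indices. So, whichever \<open>F\<close> is used, continuity
  at \<open>x0\<close> and the limit condition are equivalent, and fullness only supplies some \<open>F\<close>.
\<close>

section \<open>Suprema, seminorms and seminorm balls\<close>

lemma sup0_nonneg: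
  assumes "bdd_above (f ` A)"
  shows "0 \<le> sup0 A f"
  unfolding sup0_def using assms by (intro cSup_upper) auto

text \<open>Finiteness makes the supremum a maximum, and positivity of \<open>e\<close> absorbs the
  0 that \<open>sup0\<close> inserts. For infinite families a strict bound on the members would only
  give a weak bound on the supremum.\<close>

lemma sup0_less_iff:
  assumes "finite A" "0 < e"
  shows "sup0 A f < e \<longleftrightarrow> (\<forall>a\<in>A. f a < e)"
  unfolding sup0_def using assms by (subst finite_Sup_less_iff) auto

lemma seminorm_on_zero:
  assumes "Module.module (scalars K) M" "seminorm_on K M p" "0 \<in> K"
  shows "p \<zero>\<^bsub>M\<^esub> = 0"
proof -
  interpret Module.module "scalars K" M by fact
  have "(0::complex) \<odot>\<^bsub>M\<^esub> \<zero>\<^bsub>M\<^esub> = \<zero>\<^bsub>M\<^esub>"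
    using smult_l_null[of "\<zero>\<^bsub>M\<^esub>"] by (simp add: scalars_def)
  moreover have "p (0 \<odot>\<^bsub>M\<^esub> \<zero>\<^bsub>M\<^esub>) = cmod 0 * p \<zero>\<^bsub>M\<^esub>"
    using assms unfolding seminorm_on_def by blast
  ultimately show ?thesis by simp
qed

lemma seminorm_on_diff_triangle:
  assumes "Module.module (scalars K) M" "seminorm_on K M p"
    and "a \<in> carrier M" "b \<in> carrier M" "c \<in> carrier M"
  shows "p (a \<ominus>\<^bsub>M\<^esub> c) \<le> p (a \<ominus>\<^bsub>M\<^esub> b) + p (b \<ominus>\<^bsub>M\<^esub> c)"
proof -
  interpret Module.module "scalars K" M by fact
  have "a \<ominus>\<^bsub>M\<^esub> c = (a \<ominus>\<^bsub>M\<^esub> b) \<oplus>\<^bsub>M\<^esub> (b \<ominus>\<^bsub>M\<^esub> c)"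
    using assms(3-5) by (simp add: a_minus_def a_assoc r_neg1)
  then show ?thesis
    using assms(2-5) unfolding seminorm_on_def by (metis minus_closed)
qed

lemma topspace_seminorm_topology [simp]:
  "topspace (seminorm_topology M J p) = carrier M"
  unfolding seminorm_topology_def topology_generated_by_topspace by auto

lemma openin_seminorm_ball:
  assumes "j \<in> J" "a \<in> carrier M" "0 < r"
  shows "openin (seminorm_topology M J p) {b \<in> carrier M. p j (b \<ominus>\<^bsub>M\<^esub> a) < r}"
  unfolding seminorm_topology_def
  by (rule topology_generated_by_Basis) (use assms in blast)

section \<open>Tubes, sections and continuity at a point\<close>

lemma omega_bundle_stalk:
  assumes "omega_bundle K W" "x \<in> topspace (base W)"
  shows "Module.module (scalars K) (stalk W x)"
    and "carrier (stalk W x) = {\<alpha> \<in> topspace (total W). proj W \<alpha> = x}"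
    and "j \<in> index W \<Longrightarrow> seminorm_on K (stalk W x) (nu W j)"
  using assms unfolding omega_bundle_def by blast+

lemma omega_bundle_openin_tube:
  assumes "omega_bundle K W" "openin (base W) U" "\<sigma> \<in> cont_sections W U" "0 < \<epsilon>" "j \<in> index W"
  shows "openin (total W) (tube W U \<sigma> \<epsilon> j)"
proof -
  have "tube W U \<sigma> \<epsilon> j \<in> tubes W"
    using assms(2-) unfolding tubes_def by blast
  then have "(arbitrary union_of (\<lambda>T. T \<in> tubes W)) (tube W U \<sigma> \<epsilon> j)"
    by (simp add: arbitrary_union_of_inc)
  then show ?thesis using assms(1) by (simp add: omega_bundle_def)
qed

lemma omega_bundle_tube_nbhd:
  assumes "omega_bundle K W" "openin (total W) G" "\<alpha> \<in> G"
  obtains U \<sigma> \<epsilon> j where "openin (base W) U" "\<sigma> \<in> cont_sections W U" "0 < \<epsilon>" "j \<in> index W"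
    "\<alpha> \<in> tube W U \<sigma> \<epsilon> j" "tube W U \<sigma> \<epsilon> j \<subseteq> G"
proof -
  have "(arbitrary union_of (\<lambda>T. T \<in> tubes W)) G"
    using assms(1,2) by (simp add: omega_bundle_def)
  then obtain T where "T \<in> tubes W" "\<alpha> \<in> T" "T \<subseteq> G"
    using assms(3) unfolding union_of_def by blast
  then show ?thesis using that unfolding tubes_def by blast
qed

lemma bounded_sections_stalk:
  "\<lbrakk>\<sigma> \<in> bounded_sections W U; z \<in> U\<rbrakk> \<Longrightarrow> \<sigma> z \<in> carrier (stalk W z)"
  by (auto simp: bounded_sections_def)

lemma cont_sections_stalk:
  "\<lbrakk>\<sigma> \<in> cont_sections W U; z \<in> U\<rbrakk> \<Longrightarrow> \<sigma> z \<in> carrier (stalk W z)"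
  by (auto simp: cont_sections_def bounded_sections_def)

lemma cont_sections_openin_preimage:
  assumes "\<sigma> \<in> cont_sections W U" "openin (base W) U" "openin (total W) G"
  shows "openin (base W) {z \<in> U. \<sigma> z \<in> G}"
proof -
  have "openin (subtopology (base W) U) {z \<in> topspace (subtopology (base W) U). \<sigma> z \<in> G}"
    using assms(1,3) unfolding cont_sections_def by (blast intro: openin_continuous_map_preimage)
  moreover have "topspace (subtopology (base W) U) = U"
    using openin_subset[OF assms(2)] by auto
  ultimately have "openin (subtopology (base W) U) {z \<in> U. \<sigma> z \<in> G}"
    by (simp only:)
  then show ?thesis
    using openin_open_subtopology[OF assms(2)] by blast
qed

text \<open>Since \<open>F\<close> passes through \<open>\<U> x0\<close>, the tubes around
  restrictions of \<open>F\<close> to smaller open sets form a neighbourhood base at that point, so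
  a single section suffices to test continuity.\<close>

lemma cont_sections_at_iff_close_to_section:
  assumes W: "omega_bundle K W" and K: "0 \<in> K"
    and S: "x0 \<in> S" "S \<subseteq> topspace (base W)" and \<U>: "\<U> \<in> bounded_sections W S"
    and U: "openin (base W) U" "x0 \<in> U" and F: "F \<in> cont_sections W U" "F x0 = \<U> x0"
  shows "\<U> \<in> cont_sections_at W S x0 \<longleftrightarrow>
    (\<forall>j\<in>index W. \<forall>\<epsilon>>0. \<exists>N. openin (base W) N \<and> x0 \<in> N \<and>
       (\<forall>z\<in>N \<inter> (S \<inter> U). nu W j (\<U> z \<ominus>\<^bsub>stalk W z\<^esub> F z) < \<epsilon>))"
    (is "?L \<longleftrightarrow> ?R")
proof
  have US: "\<U> z \<in> topspace (total W)" "proj W (\<U> z) = z" "\<U> z \<in> carrier (stalk W z)"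
    if "z \<in> S" for z
    using bounded_sections_stalk[OF \<U> that] omega_bundle_stalk(2)[OF W, of z] that S by auto
  {
    assume ?L
    show ?R
    proof (intro ballI allI impI)
      fix j and \<epsilon> :: real
      assume j: "j \<in> index W" and \<epsilon>: "0 < \<epsilon>"
      have x0: "x0 \<in> topspace (base W)" using S by auto
      interpret M: Module.module "scalars K" "stalk W x0"
        using omega_bundle_stalk(1)[OF W x0] .
      have "\<U> x0 \<ominus>\<^bsub>stalk W x0\<^esub> F x0 = \<zero>\<^bsub>stalk W x0\<^esub>"
        using US[OF S(1)] F(2) by (simp add: a_minus_def M.r_neg)
      then have "\<U> x0 \<in> tube W U F \<epsilon> j"
        using US[OF S(1)] U(2) \<epsilon>
          seminorm_on_zero[OF omega_bundle_stalk(1)[OF W x0] omega_bundle_stalk(3)[OF W x0 j] K]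
        by (simp add: tube_def)
      moreover have cont: "\<forall>G. openin (total W) G \<and> \<U> x0 \<in> G \<longrightarrow>
          (\<exists>N. openin (subtopology (base W) S) N \<and> x0 \<in> N \<and> (\<forall>z\<in>N. \<U> z \<in> G))"
        using \<open>?L\<close> by (simp add: cont_sections_at_def topcontinuous_at_def)
      ultimately obtain N where N: "openin (subtopology (base W) S) N" "x0 \<in> N"
        "\<And>z. z \<in> N \<Longrightarrow> \<U> z \<in> tube W U F \<epsilon> j"
        using cont omega_bundle_openin_tube[OF W U(1) F(1) \<epsilon> j] by meson
      then obtain N' where N': "openin (base W) N'" "N = N' \<inter> S"
        by (auto simp: openin_subtopology)
      \<comment> \<open>Because \<open>\<U> z\<close> projects to \<open>z\<close>, membership in
        the tube is exactly the seminorm bound in the stalk over \<open>z\<close>.\<close>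
      have "nu W j (\<U> z \<ominus>\<^bsub>stalk W z\<^esub> F z) < \<epsilon>" if "z \<in> N' \<inter> (S \<inter> U)" for z
        using N(3)[of z] that US[of z] by (auto simp: N' tube_def)
      then show "\<exists>N. openin (base W) N \<and> x0 \<in> N \<and>
          (\<forall>z\<in>N \<inter> (S \<inter> U). nu W j (\<U> z \<ominus>\<^bsub>stalk W z\<^esub> F z) < \<epsilon>)"
        using N' N(2) by blast
    qed
  }
  {
    assume R: ?R
    have "\<exists>N. openin (subtopology (base W) S) N \<and> x0 \<in> N \<and> (\<forall>z\<in>N. \<U> z \<in> G)"
      if G: "openin (total W) G" "\<U> x0 \<in> G" for G
    proof -
      obtain U1 \<sigma> \<epsilon> j where T: "openin (base W) U1" "\<sigma> \<in> cont_sections W U1" "0 < \<epsilon>"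
        "j \<in> index W" "\<U> x0 \<in> tube W U1 \<sigma> \<epsilon> j" "tube W U1 \<sigma> \<epsilon> j \<subseteq> G"
        using omega_bundle_tube_nbhd[OF W G] by metis
      define r where "r = nu W j (\<U> x0 \<ominus>\<^bsub>stalk W x0\<^esub> \<sigma> x0)"
      have r: "r < \<epsilon>" "x0 \<in> U1"
        using T(5) US[OF S(1)] by (auto simp: tube_def r_def)
      have x0: "x0 \<in> topspace (base W)" using S by auto
      interpret M: Module.module "scalars K" "stalk W x0"
        using omega_bundle_stalk(1)[OF W x0] .
      have "0 \<le> r"
        using omega_bundle_stalk(3)[OF W x0 T(4)] US(3)[OF S(1)] cont_sections_stalk[OF T(2) r(2)]
        unfolding seminorm_on_def r_def by (meson M.minus_closed)
      \<comment> \<open>The midpoint between \<open>r\<close> and \<open>\<epsilon>\<close>: as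
        \<open>r < \<delta>\<close>, near \<open>x0\<close> the section \<open>F\<close> stays
        within \<open>\<delta>\<close> of \<open>\<sigma>\<close>, leaving the positive amount
        \<open>\<epsilon> - \<delta>\<close> for the distance from \<open>\<U>\<close> to
        \<open>F\<close>. Nonnegativity of \<open>r\<close> makes \<open>\<delta>\<close> an
        admissible tube radius.\<close>
      define \<delta> where "\<delta> = (r + \<epsilon>) / 2"
      have \<delta>: "0 < \<delta>" "r < \<delta>" "0 < \<epsilon> - \<delta>"
        using r(1) \<open>0 \<le> r\<close> by (auto simp: \<delta>_def)
      define N1 where "N1 = {z \<in> U. F z \<in> tube W U1 \<sigma> \<delta> j}"
      have N1: "openin (base W) N1"
        unfolding N1_def
        by (intro cont_sections_openin_preimage F U omega_bundle_openin_tube[OF W] T \<delta>)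
      have "x0 \<in> N1"
        using T(5) US[OF S(1)] U(2) F(2) \<delta>(2) r(2) by (auto simp: N1_def tube_def r_def)
      obtain N2 where N2: "openin (base W) N2" "x0 \<in> N2"
        "\<And>z. z \<in> N2 \<inter> (S \<inter> U) \<Longrightarrow> nu W j (\<U> z \<ominus>\<^bsub>stalk W z\<^esub> F z) < \<epsilon> - \<delta>"
        using R T(4) \<delta>(3) by meson
      have "\<U> z \<in> G" if z: "z \<in> N1 \<inter> N2 \<inter> S" for z
      proof -
        have zX: "z \<in> topspace (base W)" and zU: "z \<in> U" using z S by (auto simp: N1_def)
        have Fz: "F z \<in> carrier (stalk W z)"
          using cont_sections_stalk[OF F(1) zU] .
        then have "proj W (F z) = z" using omega_bundle_stalk(2)[OF W zX] by auto
        then have z1: "z \<in> U1" "nu W j (F z \<ominus>\<^bsub>stalk W z\<^esub> \<sigma> z) < \<delta>"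
          using z by (auto simp: N1_def tube_def)
        have "nu W j (\<U> z \<ominus>\<^bsub>stalk W z\<^esub> \<sigma> z)
            \<le> nu W j (\<U> z \<ominus>\<^bsub>stalk W z\<^esub> F z) + nu W j (F z \<ominus>\<^bsub>stalk W z\<^esub> \<sigma> z)"
          using z by (intro seminorm_on_diff_triangle[OF omega_bundle_stalk(1)[OF W zX]
                omega_bundle_stalk(3)[OF W zX T(4)]] US Fz cont_sections_stalk[OF T(2) z1(1)]) auto
        also have "\<dots> < \<epsilon>"
          using N2(3)[of z] z zU z1(2) by auto
        finally have "\<U> z \<in> tube W U1 \<sigma> \<epsilon> j"
          using z z1(1) US[of z] by (auto simp: tube_def)
        then show ?thesis using T(6) by blast
      qed
      moreover have "openin (subtopology (base W) S) (N1 \<inter> N2 \<inter> S)"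
        using N1 N2(1) by (auto simp: openin_subtopology)
      ultimately show ?thesis
        using \<open>x0 \<in> N1\<close> N2(2) S(1) by blast
    qed
    \<comment> \<open>\<open>topcontinuous_at\<close> also demands that the whole map, not just its
      germ at \<open>x0\<close>, lands in the total space.\<close>
    moreover have "\<U> \<in> topspace (subtopology (base W) S) \<rightarrow> topspace (total W)"
      using US by auto
    ultimately show ?L
      using \<U> S unfolding cont_sections_at_def topcontinuous_at_def by auto
  }
qed

section \<open>Boundedness of seminorms on compact sets\<close>

text \<open>Seminorm balls are written with \<open>a_minus\<close>, whose inverse is a definite
  description in the additive monoid. The balls used below are centred at zero, so it is enough to
  evaluate the description there.\<close>

lemma stalk_endomorphisms_minus_zero:
  assumes "Module.module (scalars K) (stalk V x)" "0 \<in> K"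
    and top: "topspace (stalk_topology V x) = carrier (stalk V x)"
  shows "\<zero>\<^bsub>stalk_endomorphisms K V x\<^esub> \<in> carrier (stalk_endomorphisms K V x)"
    and "f \<in> carrier (stalk_endomorphisms K V x)
      \<Longrightarrow> f \<ominus>\<^bsub>stalk_endomorphisms K V x\<^esub> \<zero>\<^bsub>stalk_endomorphisms K V x\<^esub> = f"
proof -
  interpret M: Module.module "scalars K" "stalk V x" by fact
  let ?E = "stalk V x" and ?L = "stalk_endomorphisms K V x"
  have cont0: "continuous_map (stalk_topology V x) (stalk_topology V x)
      (\<lambda>a\<in>carrier ?E. \<zero>\<^bsub>?E\<^esub>)"
    by (rule continuous_map_eq[of _ _ "\<lambda>a. \<zero>\<^bsub>?E\<^esub>"]) (auto simp: top)
  have smult: "k \<odot>\<^bsub>?E\<^esub> a \<in> carrier ?E" if "k \<in> K" "a \<in> carrier ?E" for k a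
    using M.smult_closed that by (simp add: scalars_def)
  have smult0: "k \<odot>\<^bsub>?E\<^esub> \<zero>\<^bsub>?E\<^esub> = \<zero>\<^bsub>?E\<^esub>" if "k \<in> K" for k
    using M.smult_r_null that by (simp add: scalars_def)
  show zero: "\<zero>\<^bsub>?L\<^esub> \<in> carrier ?L"
    using cont0 smult smult0
    by (auto simp: stalk_endomorphisms_def pointwise_module_def Let_def)
  have ext: "f \<in> carrier ?E \<rightarrow>\<^sub>E carrier ?E" if "f \<in> carrier ?L" for f
    using that by (auto simp: stalk_endomorphisms_def pointwise_module_def Let_def)
  have add0: "f \<oplus>\<^bsub>?L\<^esub> \<zero>\<^bsub>?L\<^esub> = f" "\<zero>\<^bsub>?L\<^esub> \<oplus>\<^bsub>?L\<^esub> f = f" if "f \<in> carrier ?L" for f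
    using ext[OF that]
    by (auto simp: stalk_endomorphisms_def pointwise_module_def Let_def fun_eq_iff
        PiE_def extensional_def Pi_def)
  \<comment> \<open>Uniqueness: an inverse \<open>y\<close> of zero satisfies
    \<open>0 + y = 0\<close>, while \<open>0 + y = y\<close> by \<open>add0\<close>.\<close>
  have "\<ominus>\<^bsub>?L\<^esub> \<zero>\<^bsub>?L\<^esub> = \<zero>\<^bsub>?L\<^esub>"
    unfolding a_inv_def m_inv_def
    by (rule the_equality) (use zero add0 in auto)
  then show "f \<ominus>\<^bsub>?L\<^esub> \<zero>\<^bsub>?L\<^esub> = f" if "f \<in> carrier ?L"
    using add0[OF that] by (simp add: a_minus_def)
qed

text \<open>\<open>sup0\<close> is a junk value on unbounded families, so even the nonnegativity of \<open>q_seminorm\<close> rests on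
  this bound. The balls of integer radius around the zero endomorphism form an increasing open cover,
  hence one of them contains a given compact set.\<close>

lemma bdd_above_seminorm_compact:
  assumes V: "omega_bundle K V" and "x \<in> topspace (base V)" "0 \<in> K"
    and f: "continuous_map Y (endomorphism_topology K V x T) f" and C: "compactin Y C"
    and j: "j \<in> index V" and A: "A \<in> T"
  shows "bdd_above ((\<lambda>t. sup0 A (\<lambda>a. nu V j (f t a))) ` C)"
proof -
  let ?L = "stalk_endomorphisms K V x"
  let ?p = "\<lambda>g. sup0 A (\<lambda>a. nu V j (g a))"
  \<comment> \<open>The radius is \<open>Suc n\<close> and not \<open>n\<close> because only balls
    of positive radius are among the generating open sets.\<close>
  let ?ball = "\<lambda>n::nat. {g \<in> carrier ?L. ?p g < real (Suc n)}"
  have "topspace (stalk_topology V x) = carrier (stalk V x)"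
    using omega_bundle_stalk(2)[OF assms(1,2)] by (auto simp: stalk_topology_def)
  note zero = stalk_endomorphisms_minus_zero[OF omega_bundle_stalk(1)[OF assms(1,2)] assms(3) this]
  have "openin (endomorphism_topology K V x T) (?ball n)" for n :: nat
  proof -
    have "openin (endomorphism_topology K V x T)
        {g \<in> carrier ?L. (\<lambda>(j, A) f. sup0 A (\<lambda>a. nu V j (f a))) (j, A) (g \<ominus>\<^bsub>?L\<^esub> \<zero>\<^bsub>?L\<^esub>) < real (Suc n)}"
      unfolding endomorphism_topology_def
      by (rule openin_seminorm_ball) (use j A zero(1) in auto)
    also have "{g \<in> carrier ?L. (\<lambda>(j, A) f. sup0 A (\<lambda>a. nu V j (f a))) (j, A) (g \<ominus>\<^bsub>?L\<^esub> \<zero>\<^bsub>?L\<^esub>) < real (Suc n)}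
        = ?ball n"
      using zero(2) by auto
    finally show ?thesis .
  qed
  then have op: "\<And>G. G \<in> range ?ball \<Longrightarrow> openin (endomorphism_topology K V x T) G"
    by blast
  have fC: "compactin (endomorphism_topology K V x T) (f ` C)"
    using image_compactin[OF C f] .
  have "f ` C \<subseteq> \<Union> (range ?ball)"
  proof
    fix g assume "g \<in> f ` C"
    then have "g \<in> carrier ?L"
      using compactin_subset_topspace[OF fC] by (auto simp: endomorphism_topology_def)
    moreover obtain n :: nat where "?p g < real n" using reals_Archimedean2 by blast
    ultimately have "g \<in> ?ball n" by simp
    then show "g \<in> \<Union> (range ?ball)" by blast
  qed
  then obtain \<F> where \<F>: "finite \<F>" "\<F> \<subseteq> range ?ball" "f ` C \<subseteq> \<Union> \<F>"
    using compactinD[OF fC, of "range ?ball"] op by meson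
  obtain I where "finite I" "\<F> = ?ball ` I"
    using finite_subset_image[OF \<F>(1,2)] by auto
  with \<F>(3) have I: "finite I" "f ` C \<subseteq> (\<Union>n\<in>I. ?ball n)" by simp_all
  show ?thesis
  proof (rule bdd_aboveI2)
    fix t assume "t \<in> C"
    then obtain n where "n \<in> I" "?p (f t) < real (Suc n)" using I(2) by blast
    moreover have "n \<le> Max I" using I(1) \<open>n \<in> I\<close> by simp
    ultimately show "?p (f t) \<le> real (Suc (Max I))" by linarith
  qed
qed

section \<open>Stalks and seminorms of the function bundle \<open>W\<close>\<close>

lemma Theta_E_structureD:
  assumes "Theta_E_structure K V W Y \<Theta> \<E>"
  shows "omega_bundle K V" "omega_bundle K W" "base W = base V"
    and "\<E> \<subseteq> cont_sections V (topspace (base V))"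
    and "index W = {Q. finite Q \<and> Q \<subseteq> {C. compactin Y C} \<times> index V \<times> \<Theta>}"
    and "\<forall>Q\<in>index W. \<forall>(x, f)\<in>topspace (total W).
      nu W Q (x, f) = sup0 Q (\<lambda>i. q_seminorm V \<E> i x f)"
  using assms unfolding Theta_E_structure_def by - (elim conjE, assumption)+

lemma Theta_E_structure_stalk:
  assumes "Theta_E_structure K V W Y \<Theta> \<E>" "x \<in> topspace (base V)" "\<alpha> \<in> carrier (stalk W x)"
  shows "fst \<alpha> = x"
    and "continuous_map Y (endomorphism_topology K V x (B_values V \<E> x ` \<Theta>)) (snd \<alpha>)"
    and "\<lbrakk>t \<in> topspace Y; a \<in> carrier (stalk V x)\<rbrakk> \<Longrightarrow> snd \<alpha> t a \<in> carrier (stalk V x)"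
    and "\<lbrakk>\<beta> \<in> carrier (stalk W x); t \<in> topspace Y; a \<in> carrier (stalk V x)\<rbrakk>
      \<Longrightarrow> snd (\<alpha> \<oplus>\<^bsub>stalk W x\<^esub> \<beta>) t a = snd \<alpha> t a \<oplus>\<^bsub>stalk V x\<^esub> snd \<beta> t a"
proof -
  define F where "F = cont_endomorphism_maps K V Y x (B_values V \<E> x ` \<Theta>)"
  obtain M where M: "submodule M (scalars K) F" "carrier (stalk W x) = Pair x ` M"
    "\<And>f g. \<lbrakk>f \<in> M; g \<in> M\<rbrakk> \<Longrightarrow> (x, f) \<oplus>\<^bsub>stalk W x\<^esub> (x, g) = (x, f \<oplus>\<^bsub>F\<^esub> g)"
  proof -
    have "\<forall>x\<in>topspace (base V).
        let F = cont_endomorphism_maps K V Y x (B_values V \<E> x ` \<Theta>) in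
        \<exists>M. submodule M (scalars K) F \<and>
            carrier (stalk W x) = Pair x ` M \<and>
            (\<forall>f\<in>M. \<forall>g\<in>M. (x, f) \<oplus>\<^bsub>stalk W x\<^esub> (x, g) = (x, f \<oplus>\<^bsub>F\<^esub> g)) \<and>
            (\<forall>k\<in>K. \<forall>f\<in>M. k \<odot>\<^bsub>stalk W x\<^esub> (x, f) = (x, k \<odot>\<^bsub>F\<^esub> f))"
      using assms(1) unfolding Theta_E_structure_def by (elim conjE)
    from bspec[OF this assms(2)] show ?thesis
      using that unfolding Let_def F_def[symmetric] by (elim exE conjE) simp
  qed
  have MF: "M \<subseteq> carrier F"
    using M(1) by (auto simp: submodule_def subgroup_def)
  show "fst \<alpha> = x" using assms(3) M(2) by auto
  have "snd \<alpha> \<in> carrier F" using assms(3) M(2) MF by auto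
  then show cont: "continuous_map Y (endomorphism_topology K V x (B_values V \<E> x ` \<Theta>)) (snd \<alpha>)"
    by (simp add: F_def cont_endomorphism_maps_def pointwise_module_def)
  show "snd \<alpha> t a \<in> carrier (stalk V x)" if "t \<in> topspace Y" "a \<in> carrier (stalk V x)"
  proof -
    \<comment> \<open>The carrier of \<open>cont_endomorphism_maps\<close> records only
      extensionality and continuity. That the values are endomorphisms follows because a continuous
      map lands in the topspace of its codomain.\<close>
    have "snd \<alpha> t \<in> carrier (stalk_endomorphisms K V x)"
      using continuous_map_image_subset_topspace[OF cont] that(1)
      by (auto simp: endomorphism_topology_def)
    then show ?thesis
      using that(2) by (auto simp: stalk_endomorphisms_def pointwise_module_def Let_def)
  qed
  show "snd (\<alpha> \<oplus>\<^bsub>stalk W x\<^esub> \<beta>) t a = snd \<alpha> t a \<oplus>\<^bsub>stalk V x\<^esub> snd \<beta> t a"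
    if "\<beta> \<in> carrier (stalk W x)" "t \<in> topspace Y" "a \<in> carrier (stalk V x)"
    using that assms(3) M(2,3)
    by (auto simp: F_def cont_endomorphism_maps_def pointwise_module_def
        stalk_endomorphisms_def Let_def)
qed

text \<open>The structure ties only addition and scalar multiplication of \<open>W\<close> to the
  pointwise ones. Subtraction is recovered by evaluating \<alpha> = (\<alpha> - \<beta>) + \<beta>
  at \<open>t\<close> and \<open>a\<close> and cancelling in the stalk of \<open>V\<close>.\<close>

lemma Theta_E_structure_minus:
  assumes T: "Theta_E_structure K V W Y \<Theta> \<E>" and x: "x \<in> topspace (base V)"
    and \<alpha>: "\<alpha> \<in> carrier (stalk W x)" and \<beta>: "\<beta> \<in> carrier (stalk W x)"
    and t: "t \<in> topspace Y" and a: "a \<in> carrier (stalk V x)"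
  shows "snd (\<alpha> \<ominus>\<^bsub>stalk W x\<^esub> \<beta>) t a = snd \<alpha> t a \<ominus>\<^bsub>stalk V x\<^esub> snd \<beta> t a"
proof -
  have V: "omega_bundle K V" and W: "omega_bundle K W" and b: "base W = base V"
    by (fact Theta_E_structureD[OF T])+
  interpret V: Module.module "scalars K" "stalk V x"
    using omega_bundle_stalk(1)[OF V x] .
  interpret W: Module.module "scalars K" "stalk W x"
    using omega_bundle_stalk(1)[OF W] x b by simp
  note S = Theta_E_structure_stalk[OF T x]
  let ?\<gamma> = "\<alpha> \<ominus>\<^bsub>stalk W x\<^esub> \<beta>"
  have \<gamma>: "?\<gamma> \<in> carrier (stalk W x)" using \<alpha> \<beta> by simp
  have "\<alpha> = ?\<gamma> \<oplus>\<^bsub>stalk W x\<^esub> \<beta>"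
    using \<alpha> \<beta> by (simp add: a_minus_def W.a_assoc W.l_neg)
  then have "snd \<alpha> t a = snd ?\<gamma> t a \<oplus>\<^bsub>stalk V x\<^esub> snd \<beta> t a"
    using S(4)[OF \<gamma> \<beta> t a] by simp
  then show ?thesis
    using S(3)[OF \<gamma> t a] S(3)[OF \<beta> t a] by (simp add: a_minus_def V.a_assoc V.r_neg)
qed

text \<open>By compactness the outer supremum is over a bounded family, so the inserted 0 is a
  genuine lower bound. This lets convergence to 0 be tested by upper bounds alone.\<close>

lemma q_seminorm_nonneg:
  assumes T: "Theta_E_structure K V W Y \<Theta> \<E>" and "0 \<in> K" and x: "x \<in> topspace (base V)"
    and \<alpha>: "\<alpha> \<in> carrier (stalk W x)" and C: "compactin Y C" and j: "j \<in> index V" and B: "B \<in> \<Theta>"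
  shows "0 \<le> q_seminorm V \<E> (C, j, B) x (snd \<alpha>)"
proof -
  have V: "omega_bundle K V" by (fact Theta_E_structureD[OF T])
  \<comment> \<open>\<open>B_values\<close> is the image of \<open>D_sections\<close> under
    evaluation at \<open>x\<close>, so this inner supremum is the one over sections in
    \<open>q_seminorm\<close>.\<close>
  have "bdd_above ((\<lambda>t. sup0 (B_values V \<E> x B) (\<lambda>a. nu V j (snd \<alpha> t a))) ` C)"
    using B by (intro bdd_above_seminorm_compact[OF V x assms(2)
          Theta_E_structure_stalk(2)[OF T x \<alpha>] C j]) auto
  then show ?thesis
    by (auto simp: q_seminorm_def sup0_def B_values_def image_image
        intro!: sup0_nonneg[unfolded sup0_def])
qed

text \<open>\<open>Q\<close> is finite, so \<open>sup0_less_iff\<close> applies. It may be empty: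
  then the seminorm is 0 and the right side is vacuous.\<close>

lemma Theta_E_structure_nu_less_iff:
  assumes T: "Theta_E_structure K V W Y \<Theta> \<E>" and x: "x \<in> topspace (base V)"
    and \<alpha>: "\<alpha> \<in> carrier (stalk W x)" and Q: "Q \<in> index W" and \<epsilon>: "0 < \<epsilon>"
  shows "nu W Q \<alpha> < \<epsilon> \<longleftrightarrow> (\<forall>i\<in>Q. q_seminorm V \<E> i x (snd \<alpha>) < \<epsilon>)"
proof -
  have W: "omega_bundle K W" and b: "base W = base V"
    and i: "index W = {Q. finite Q \<and> Q \<subseteq> {C. compactin Y C} \<times> index V \<times> \<Theta>}"
    and nu: "\<forall>Q\<in>index W. \<forall>(x, f)\<in>topspace (total W).
      nu W Q (x, f) = sup0 Q (\<lambda>i. q_seminorm V \<E> i x f)"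
    by (fact Theta_E_structureD[OF T])+
  have eq: "\<alpha> = (x, snd \<alpha>)"
    using Theta_E_structure_stalk(1)[OF T x \<alpha>] by (metis prod.collapse)
  have "\<alpha> \<in> topspace (total W)"
    using omega_bundle_stalk(2)[OF W, of x] x b \<alpha> by auto
  then have "(x, snd \<alpha>) \<in> topspace (total W)" using eq by simp
  then have "nu W Q (x, snd \<alpha>) = sup0 Q (\<lambda>i. q_seminorm V \<E> i x (snd \<alpha>))"
    using bspec[OF bspec[OF nu Q]] by fast
  then have "nu W Q \<alpha> = sup0 Q (\<lambda>i. q_seminorm V \<E> i x (snd \<alpha>))"
    using eq by simp
  moreover have "finite Q" using Q i by simp
  ultimately show ?thesis
    using sup0_less_iff[OF _ \<epsilon>] by metis
qed

section \<open>The uniform limit condition in terms of the seminorms of \<open>W\<close>\<close>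

text \<open>The double supremum in the limit is the seminorm of the difference for the singleton
  index \<open>{(C, j, B)}\<close>.\<close>

lemma uniform_limit_condition_iff:
  assumes T: "Theta_E_structure K V W Y \<Theta> \<E>" and K: "0 \<in> K"
    and S: "x0 \<in> S" "S \<subseteq> topspace (base V)" and \<U>: "\<U> \<in> bounded_sections W S"
    and U: "x0 \<in> U" and F: "F \<in> cont_sections W U" "F x0 = \<U> x0"
    and C: "compactin Y C" and j: "j \<in> index V" and B: "B \<in> \<Theta>"
  shows "uniform_limit_condition V \<E> S x0 \<U> U F j C B \<longleftrightarrow>
    (\<forall>\<epsilon>>0. \<exists>N. openin (base V) N \<and> x0 \<in> N \<and>
       (\<forall>z\<in>N \<inter> (S \<inter> U). nu W {(C, j, B)} (\<U> z \<ominus>\<^bsub>stalk W z\<^esub> F z) < \<epsilon>))"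
proof -
  let ?i = "(C, j, B)"
  define g where "g = (\<lambda>z. sup0 C (\<lambda>t. sup0 (D_sections V \<E> B) (\<lambda>v.
    nu V j (snd (\<U> z) t (v z) \<ominus>\<^bsub>stalk V z\<^esub> snd (F z) t (v z)))))"
  have W: "omega_bundle K W" and b: "base W = base V"
    and ES: "\<E> \<subseteq> cont_sections V (topspace (base V))"
    and i: "index W = {Q. finite Q \<and> Q \<subseteq> {C. compactin Y C} \<times> index V \<times> \<Theta>}"
    by (fact Theta_E_structureD[OF T])+
  have iW: "{?i} \<in> index W" using C j B i by auto
  have mod: "Module.module (scalars K) (stalk W z)" if "z \<in> S" for z
    using omega_bundle_stalk(1)[OF W] that S(2) b by auto
  have diff: "\<U> z \<ominus>\<^bsub>stalk W z\<^esub> F z \<in> carrier (stalk W z)" if "z \<in> S \<inter> U" for z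
  proof -
    interpret Module.module "scalars K" "stalk W z" using mod that by blast
    show ?thesis using bounded_sections_stalk[OF \<U>] cont_sections_stalk[OF F(1)] that by auto
  qed
  \<comment> \<open>Members of \<open>\<E>\<close> are sections, so \<open>v z\<close> lies in the
    stalk over \<open>z\<close>; at such vectors the difference formed in \<open>W\<close> acts
    pointwise.\<close>
  have g: "g z = q_seminorm V \<E> ?i z (snd (\<U> z \<ominus>\<^bsub>stalk W z\<^esub> F z))" if z: "z \<in> S \<inter> U" for z
  proof -
    have zX: "z \<in> topspace (base V)" using z S(2) by auto
    have "snd (\<U> z) t (v z) \<ominus>\<^bsub>stalk V z\<^esub> snd (F z) t (v z)
        = snd (\<U> z \<ominus>\<^bsub>stalk W z\<^esub> F z) t (v z)" if "t \<in> C" "v \<in> D_sections V \<E> B" for t v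
    proof -
      have "v z \<in> carrier (stalk V z)"
        using that(2) ES cont_sections_stalk[OF _ zX] by (auto simp: D_sections_def)
      moreover have "t \<in> topspace Y" using that(1) compactin_subset_topspace[OF C] by auto
      ultimately show ?thesis
        using Theta_E_structure_minus[OF T zX] z bounded_sections_stalk[OF \<U>]
          cont_sections_stalk[OF F(1)] by simp
    qed
    then show ?thesis
      unfolding g_def q_seminorm_def sup0_def by (simp cong: image_cong)
  qed
  have g0: "0 \<le> g z" if "z \<in> S \<inter> U" for z
    using q_seminorm_nonneg[OF T K _ diff[OF that] C j B] g[OF that] that S(2) by auto
  have nu: "nu W {?i} (\<U> z \<ominus>\<^bsub>stalk W z\<^esub> F z) < \<epsilon> \<longleftrightarrow> g z < \<epsilon>"
    if "z \<in> S \<inter> U" "0 < \<epsilon>" for z \<epsilon>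
    using Theta_E_structure_nu_less_iff[OF T _ diff[OF that(1)] iW that(2)] g[OF that(1)] that S(2)
    by auto
  \<comment> \<open>The filter \<open>atin_within\<close> omits \<open>x0\<close>, whereas the
    neighbourhood formulation includes it. The difference vanishes there, so both agree.\<close>
  have x0: "g x0 < \<epsilon>" if "0 < \<epsilon>" for \<epsilon>
  proof -
    have x0: "x0 \<in> topspace (base W)" using S b by auto
    interpret Module.module "scalars K" "stalk W x0" using mod S by blast
    have "\<U> x0 \<ominus>\<^bsub>stalk W x0\<^esub> F x0 = \<zero>\<^bsub>stalk W x0\<^esub>"
      using bounded_sections_stalk[OF \<U> S(1)] F(2) by (simp add: a_minus_def r_neg)
    then show ?thesis
      using nu[of x0 \<epsilon>] that U S(1)
        seminorm_on_zero[OF mod[OF S(1)] omega_bundle_stalk(3)[OF W x0 iW] K] by simp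
  qed
  have "uniform_limit_condition V \<E> S x0 \<U> U F j C B \<longleftrightarrow>
      (\<forall>\<epsilon>>0. \<exists>N. openin (base V) N \<and> x0 \<in> N \<and> (\<forall>z\<in>N. z \<in> S \<inter> U \<and> z \<noteq> x0 \<longrightarrow> dist (g z) 0 < \<epsilon>))"
    using S unfolding uniform_limit_condition_def g_def[symmetric] tendsto_iff eventually_atin_within
    by auto
  also have "\<dots> \<longleftrightarrow> (\<forall>\<epsilon>>0. \<exists>N. openin (base V) N \<and> x0 \<in> N \<and> (\<forall>z\<in>N \<inter> (S \<inter> U). g z < \<epsilon>))"
  proof -
    have "(\<forall>z\<in>N. z \<in> S \<inter> U \<and> z \<noteq> x0 \<longrightarrow> dist (g z) 0 < \<epsilon>) \<longleftrightarrow> (\<forall>z\<in>N \<inter> (S \<inter> U). g z < \<epsilon>)"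
      if "0 < \<epsilon>" for N \<epsilon>
      using x0[OF that] g0 by (auto simp: dist_real_def abs_of_nonneg)
    then show ?thesis by simp
  qed
  also have "\<dots> \<longleftrightarrow> (\<forall>\<epsilon>>0. \<exists>N. openin (base V) N \<and> x0 \<in> N \<and>
       (\<forall>z\<in>N \<inter> (S \<inter> U). nu W {?i} (\<U> z \<ominus>\<^bsub>stalk W z\<^esub> F z) < \<epsilon>))"
    using nu by simp
  finally show ?thesis .
qed

text \<open>Continuity concerns all finite index sets \<open>Q\<close>, the limits only singletons.
  Intersecting the finitely many neighbourhoods of the members of \<open>Q\<close> bridges the
  gap.\<close>

lemma cont_sections_at_iff_uniform_limits:
  assumes T: "Theta_E_structure K V W Y \<Theta> \<E>" and K: "0 \<in> K"
    and S: "x0 \<in> S" "S \<subseteq> topspace (base V)" and \<U>: "\<U> \<in> bounded_sections W S"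
    and U: "openin (base V) U" "x0 \<in> U" and F: "F \<in> cont_sections W U" "F x0 = \<U> x0"
  shows "\<U> \<in> cont_sections_at W S x0 \<longleftrightarrow>
    (\<forall>j\<in>index V. \<forall>C. compactin Y C \<longrightarrow>
       (\<forall>B\<in>\<Theta>. uniform_limit_condition V \<E> S x0 \<U> U F j C B))"
    (is "_ \<longleftrightarrow> ?R")
proof -
  have W: "omega_bundle K W" and b: "base W = base V"
    and i: "index W = {Q. finite Q \<and> Q \<subseteq> {C. compactin Y C} \<times> index V \<times> \<Theta>}"
    by (fact Theta_E_structureD[OF T])+
  define P where "P = (\<lambda>Q \<epsilon>. \<exists>N. openin (base V) N \<and> x0 \<in> N \<and>
       (\<forall>z\<in>N \<inter> (S \<inter> U). nu W Q (\<U> z \<ominus>\<^bsub>stalk W z\<^esub> F z) < \<epsilon>))"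
  have lim: "?R \<longleftrightarrow> (\<forall>i \<in> {C. compactin Y C} \<times> index V \<times> \<Theta>. \<forall>\<epsilon>>0. P {i} \<epsilon>)"
    using uniform_limit_condition_iff[OF T K S \<U> U(2) F] unfolding P_def by auto
  have "P Q \<epsilon>" if Q: "Q \<in> index W" and \<epsilon>: "0 < \<epsilon>" and PQ: "\<And>i. i \<in> Q \<Longrightarrow> P {i} \<epsilon>" for Q \<epsilon>
  proof -
    obtain N where N: "\<And>i. i \<in> Q \<Longrightarrow> openin (base V) (N i) \<and> x0 \<in> N i \<and>
       (\<forall>z\<in>N i \<inter> (S \<inter> U). nu W {i} (\<U> z \<ominus>\<^bsub>stalk W z\<^esub> F z) < \<epsilon>)"
      using PQ unfolding P_def by metis
    \<comment> \<open>The factor \<open>topspace (base V)\<close> keeps the intersection open when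
      \<open>Q\<close> is empty.\<close>
    define N' where "N' = topspace (base V) \<inter> \<Inter> (N ` Q)"
    have "openin (base V) N'"
      unfolding N'_def using N Q i by (intro openin_Int_Inter) auto
    moreover have "x0 \<in> N'" using N S by (auto simp: N'_def)
    moreover have "nu W Q (\<U> z \<ominus>\<^bsub>stalk W z\<^esub> F z) < \<epsilon>" if z: "z \<in> N' \<inter> (S \<inter> U)" for z
    proof -
      have zX: "z \<in> topspace (base V)" using z S(2) by auto
      interpret Module.module "scalars K" "stalk W z"
        using omega_bundle_stalk(1)[OF W] zX b by auto
      have d: "\<U> z \<ominus>\<^bsub>stalk W z\<^esub> F z \<in> carrier (stalk W z)"
        using bounded_sections_stalk[OF \<U>] cont_sections_stalk[OF F(1)] z by auto
      have "q_seminorm V \<E> i z (snd (\<U> z \<ominus>\<^bsub>stalk W z\<^esub> F z)) < \<epsilon>" if iQ: "i \<in> Q" for i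
      proof -
        have "{i} \<in> index W" using Q iQ \<open>index W = _\<close> by auto
        moreover have "nu W {i} (\<U> z \<ominus>\<^bsub>stalk W z\<^esub> F z) < \<epsilon>"
          using N[OF iQ] z iQ by (auto simp: N'_def)
        ultimately show ?thesis
          using Theta_E_structure_nu_less_iff[OF T zX d _ \<epsilon>] by blast
      qed
      then show ?thesis
        using Theta_E_structure_nu_less_iff[OF T zX d Q \<epsilon>] by blast
    qed
    ultimately show ?thesis unfolding P_def by blast
  qed
  moreover have "\<U> \<in> cont_sections_at W S x0 \<longleftrightarrow> (\<forall>Q\<in>index W. \<forall>\<epsilon>>0. P Q \<epsilon>)"
    using cont_sections_at_iff_close_to_section[OF W K S(1) _ \<U> _ U(2) F] S(2) U(1) b
    unfolding P_def by simp
  moreover have "{i} \<in> index W" if "i \<in> {C. compactin Y C} \<times> index V \<times> \<Theta>" for i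
    using that \<open>index W = _\<close> by auto
  moreover have "i \<in> {C. compactin Y C} \<times> index V \<times> \<Theta>" if "Q \<in> index W" "i \<in> Q" for i Q
    using that \<open>index W = _\<close> by auto
  ultimately show ?thesis unfolding lim by meson
qed

section \<open>Comparison of the four conditions\<close>

theorem lemma1p4p11:
  fixes K :: "complex set"
    and V :: "('e, 'x, 'j) bundle_data"
    and W :: "('x \<times> ('y \<Rightarrow> 'e \<Rightarrow> 'e), 'x, ('y set \<times> 'j \<times> ('x \<Rightarrow> 'e set)) set) bundle_data"
    and Y :: "'y topology"
    and \<Theta> :: "('x \<Rightarrow> 'e set) set"
    and \<E> :: "('x \<Rightarrow> 'e) set"
    and S :: "'x set"
    and x0 :: 'x
    and \<U> :: "'x \<Rightarrow> 'x \<times> ('y \<Rightarrow> 'e \<Rightarrow> 'e)"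
  assumes "K = \<real> \<or> K = UNIV"
    and "Theta_E_structure K V W Y \<Theta> \<E>"
    and "x0 \<in> S" and "S \<subseteq> topspace (base V)"
    and "\<U> \<in> bounded_sections W S"
  shows
    "let X = topspace (base V);
         nbhds = {U. openin (base V) U \<and> x0 \<in> U};
         limits = (\<lambda>U F. \<forall>j\<in>index V. \<forall>C. compactin Y C \<longrightarrow>
           (\<forall>B\<in>\<Theta>. uniform_limit_condition V \<E> S x0 \<U> U F j C B));
         c1 = (\<U> \<in> cont_sections_at W S x0);
         c2 = (\<lambda>N. \<exists>U\<in>N. \<exists>F\<in>cont_sections W U. F x0 = \<U> x0 \<and> limits U F);
         c3 = (\<lambda>N. (\<exists>U'\<in>N. \<exists>F'\<in>cont_sections W U'. F' x0 = \<U> x0) \<and>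
           (\<forall>U\<in>nbhds. \<forall>F\<in>cont_sections W U. F x0 = \<U> x0 \<longrightarrow> limits U F));
         c4 = (\<lambda>N. (\<exists>U'\<in>N. \<exists>F'\<in>cont_sections W U'. F' x0 = \<U> x0) \<and>
           \<U> \<in> cont_sections_at W S x0)
     in (c3 nbhds \<longleftrightarrow> c4 nbhds) \<and> (c3 nbhds \<longrightarrow> c2 nbhds) \<and> (c2 nbhds \<longrightarrow> c1) \<and>
        (locally_full W \<longrightarrow>
           (c1 \<longleftrightarrow> c2 nbhds) \<and> (c2 nbhds \<longleftrightarrow> c3 nbhds) \<and> (c3 nbhds \<longleftrightarrow> c4 nbhds)) \<and>
        (full W \<longrightarrow>
           (c1 \<longleftrightarrow> c2 nbhds) \<and> (c2 nbhds \<longleftrightarrow> c3 nbhds) \<and> (c3 nbhds \<longleftrightarrow> c4 nbhds) \<and>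
           (c2 nbhds \<longleftrightarrow> c2 {X}) \<and> (c3 nbhds \<longleftrightarrow> c3 {X}) \<and> (c4 nbhds \<longleftrightarrow> c4 {X}))"
proof -
  have K0: "0 \<in> K" using assms(1) by auto
  have W: "omega_bundle K W" and b: "base W = base V"
    by (fact Theta_E_structureD[OF assms(2)])+
  note key = cont_sections_at_iff_uniform_limits[OF assms(2) K0 assms(3-5)]
  have x0: "x0 \<in> topspace (base V)" using assms(3,4) by auto
  have \<U>0: "\<U> x0 \<in> topspace (total W)" "proj W (\<U> x0) = x0"
    using bounded_sections_stalk[OF assms(5,3)] omega_bundle_stalk(2)[OF W, of x0] x0 b by auto
  define A where "A = (\<U> \<in> cont_sections_at W S x0)"
  define lims where "lims U F \<longleftrightarrow> (\<forall>j\<in>index V. \<forall>C. compactin Y C \<longrightarrow>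
    (\<forall>B\<in>\<Theta>. uniform_limit_condition V \<E> S x0 \<U> U F j C B))" for U F
  define nbhds where "nbhds = {U. openin (base V) U \<and> x0 \<in> U}"
  define Ext where "Ext N \<longleftrightarrow> (\<exists>U\<in>N. \<exists>F\<in>cont_sections W U. F x0 = \<U> x0)" for N
  \<comment> \<open>The truth value of the limits is the same for every admissible \<open>U\<close>
    and \<open>F\<close>. Hence each of (2), (3), (4) over a family \<open>N\<close> reduces to
    \<open>Ext N\<close> together with \<open>A\<close>.\<close>
  have lims: "lims U F = A" if "U \<in> nbhds" "F \<in> cont_sections W U" "F x0 = \<U> x0" for U F
    using key[of U F] that unfolding lims_def A_def nbhds_def by simp
  have X: "{topspace (base V)} \<subseteq> nbhds" using x0 by (simp add: nbhds_def)
  have c2: "(\<exists>U\<in>N. \<exists>F\<in>cont_sections W U. F x0 = \<U> x0 \<and> lims U F) \<longleftrightarrow> Ext N \<and> A"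
    if "N \<subseteq> nbhds" for N
    using lims that unfolding Ext_def by blast
  \<comment> \<open>The universal quantifier ranges over \<open>nbhds\<close> even when
    \<open>N\<close> is smaller; the witness of \<open>Ext N\<close> lies in \<open>nbhds\<close>
    and so yields \<open>A\<close>.\<close>
  have c3: "Ext N \<and> (\<forall>U\<in>nbhds. \<forall>F\<in>cont_sections W U. F x0 = \<U> x0 \<longrightarrow> lims U F) \<longleftrightarrow> Ext N \<and> A"
    if "N \<subseteq> nbhds" for N
    using lims that unfolding Ext_def by blast
  have loc: "Ext nbhds" if "locally_full W"
    using that \<U>0 b unfolding locally_full_def Ext_def nbhds_def by (metis mem_Collect_eq)
  have glob: "Ext {topspace (base V)}" if "full W"
    using that \<U>0 b unfolding full_def Ext_def by (metis insertI1)
  \<comment> \<open>The whole base is itself an open neighbourhood of \<open>x0\<close>. For full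
    \<open>W\<close> both existence statements hold, so restricting the choice to the whole base
    changes nothing.\<close>
  have "Ext {topspace (base V)} \<Longrightarrow> Ext nbhds"
    using X unfolding Ext_def by blast
  then show ?thesis
    unfolding Let_def lims_def[symmetric] A_def[symmetric] nbhds_def[symmetric]
      Ext_def[symmetric] c2[OF order.refl] c3[OF order.refl] c2[OF X] c3[OF X]
    using loc glob by blast
qed

end
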